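(* There is a polynomial-time algorithm that, given a graph $G=(V,E)$ and a family $\mathcal{B}\subseteq 2^V$, outputs a vertex cover $W$ of $G$ with $\max_{B\in\mathcal{B}}|W\cap B|\leq 2k^\star$, where $k^\star$ is the minimum of $\max_{B\in\mathcal{B}}|H\cap B|$ over all vertex covers $H$ of $G$.
   Context: This is a 2-approximation for the Sparse Vertex Cover problem: a feasible solution is a vertex cover $H\subseteq V$ (a set meeting every edge), and its sparseness is $\max_{B\in\mathcal{B}}|H\cap B|$, to be minimized. *)

theory Defs
  imports
    "HOL-Computational_Algebra.Polynomial"
    "HOL-Library.Log_Nat"
begin

section \<open>Graphs, vertex covers and sparseness\<close>

definition simple_graph :: "'a set \<Rightarrow> 'a set set \<Rightarrow> bool" where
  "simple_graph V E \<longleftrightarrow> finite V \<and> (\<forall>e\<in>E. e \<subseteq> V \<and> card e = 2)"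

definition vertex_cover :: "'a set \<Rightarrow> 'a set set \<Rightarrow> 'a set \<Rightarrow> bool" where
  "vertex_cover V E H \<longleftrightarrow> H \<subseteq> V \<and> (\<forall>e\<in>E. H \<inter> e \<noteq> {})"

text \<open>The element 0 only matters for the empty family, where the maximum is read as 0.\<close>

definition sparseness :: "'a set set \<Rightarrow> 'a set \<Rightarrow> nat" where
  "sparseness \<B> H = Max (insert 0 ((\<lambda>B. card (H \<inter> B)) ` \<B>))"

definition min_sparseness :: "'a set \<Rightarrow> 'a set set \<Rightarrow> 'a set set \<Rightarrow> nat" where
  "min_sparseness V E \<B> = Min (sparseness \<B> ` {H. vertex_cover V E H})"


section \<open>The machine model\<close>

text \<open>
  Algorithms are structured programs for a random access machine with unit cost. The memory consists
  of arrays of natural numbers, of unbounded length and addressed by computed indices; a scalar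
  variable is an array used at a fixed index. A program names only finitely many arrays, so they can
  be interleaved in the single memory of a textbook machine.

  The only arithmetic operations are addition and truncated subtraction. A program is fixed
  independently of its input and its expressions have bounded size, so each step
  increases the bit length of the largest number in memory by at most a constant. This is why
  unit-cost time on this machine agrees up to a polynomial with time on a Turing machine; with
  multiplication as a unit-cost operation it would not.
\<close>

type_synonym state = "string \<Rightarrow> nat \<Rightarrow> nat"

datatype aexp =
    Const nat
  | Read string aexp
  | Plus aexp aexp
  | Minus aexp aexp

fun aval :: "aexp \<Rightarrow> state \<Rightarrow> nat" where
  "aval (Const n) s = n"
| "aval (Read x a) s = s x (aval a s)"
| "aval (Plus a b) s = aval a s + aval b s"
| "aval (Minus a b) s = aval a s - aval b s"

datatype com =
    Skip
  | Write string aexp aexp  \<comment> \<open>array, index, value\<close>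
  | Seq com com
  | If aexp com com
  | While aexp com

text \<open>
  \<open>exec c s t s'\<close>: started in memory \<open>s\<close>, the program \<open>c\<close> halts after \<open>t\<close> steps with memory \<open>s'\<close>.
  A guard counts as true when its value is nonzero.
\<close>

inductive exec :: "com \<Rightarrow> state \<Rightarrow> nat \<Rightarrow> state \<Rightarrow> bool" where
  Skip: "exec Skip s 1 s"
| Write: "exec (Write x a b) s 1 (s(x := (s x)(aval a s := aval b s)))"
| Seq: "exec c1 s1 t1 s2 \<Longrightarrow> exec c2 s2 t2 s3 \<Longrightarrow> exec (Seq c1 c2) s1 (t1 + t2) s3"
| IfTrue: "aval a s \<noteq> 0 \<Longrightarrow> exec c1 s t s' \<Longrightarrow> exec (If a c1 c2) s (1 + t) s'"
| IfFalse: "aval a s = 0 \<Longrightarrow> exec c2 s t s' \<Longrightarrow> exec (If a c1 c2) s (1 + t) s'"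
| WhileFalse: "aval a s = 0 \<Longrightarrow> exec (While a c) s 1 s"
| WhileTrue: "aval a s1 \<noteq> 0 \<Longrightarrow> exec c s1 t1 s2 \<Longrightarrow> exec (While a c) s2 t2 s3 \<Longrightarrow>
    exec (While a c) s1 (1 + t1 + t2) s3"

lemma exec_deterministic:
  "exec c s t s' \<Longrightarrow> exec c s u s'' \<Longrightarrow> u = t \<and> s'' = s'"
proof (induction arbitrary: u s'' rule: exec.induct)
  case (Skip s)
  from Skip.prems show ?case by cases simp
next
  case (Write x a s b)
  from Write.prems show ?case by cases simp
next
  case (Seq c1 s1 t1 s2 c2 t2 s3)
  from Seq.prems obtain v1 r v2
    where *: "u = v1 + v2" "exec c1 s1 v1 r" "exec c2 r v2 s''" by cases simp
  from Seq.IH(1)[OF *(2)] Seq.IH(2)[of v2 s''] * show ?case by simp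
next
  case (IfTrue a s c1 t s' c2)
  from IfTrue.prems IfTrue.hyps obtain v where *: "u = 1 + v" "exec c1 s v s''"
    by cases simp_all
  from IfTrue.IH[OF *(2)] * show ?case by simp
next
  case (IfFalse a s c2 t s' c1)
  from IfFalse.prems IfFalse.hyps obtain v where *: "u = 1 + v" "exec c2 s v s''"
    by cases simp_all
  from IfFalse.IH[OF *(2)] * show ?case by simp
next
  case (WhileFalse a s c)
  from WhileFalse.prems WhileFalse.hyps show ?case by cases simp_all
next
  case (WhileTrue a s1 c t1 s2 t2 s3)
  from WhileTrue.prems WhileTrue.hyps(1) obtain v1 r v2
    where *: "u = 1 + v1 + v2" "exec c s1 v1 r" "exec (While a c) r v2 s''"
    by cases simp_all
  from WhileTrue.IH(1)[OF *(2)] WhileTrue.IH(2)[of v2 s''] * show ?case by simp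
qed

definition initial_state :: "nat list \<Rightarrow> state" where
  "initial_state xs = (\<lambda>x i. if x = ''in'' \<and> i < length xs then xs ! i else 0)"

text \<open>The output array holds the length of the output list, followed by its elements.\<close>

definition output_list :: "state \<Rightarrow> nat list" where
  "output_list s = map (s ''out'') [1..<Suc (s ''out'' 0)]"


section \<open>Encoding of instances\<close>

text \<open>
  Vertices are natural numbers. An instance is encoded by listing the vertices, the edges and the
  members of the family, each list preceded by its length. All listings are without repetitions
  but in arbitrary order, so that an instance has many encodings.
\<close>

definition encodes_instance ::
  "nat set \<Rightarrow> nat set set \<Rightarrow> nat set set \<Rightarrow> nat list \<Rightarrow> bool" where
  "encodes_instance V E \<B> xs \<longleftrightarrow>
    (\<exists>vs es bss.
      distinct vs \<and> set vs = V \<and>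
      distinct (map (\<lambda>(u, v). {u, v}) es) \<and> set (map (\<lambda>(u, v). {u, v}) es) = E \<and>
      (\<forall>bs\<in>set bss. distinct bs) \<and> distinct (map set bss) \<and> set (map set bss) = \<B> \<and>
      xs = length vs # vs @
           length es # concat (map (\<lambda>(u, v). [u, v]) es) @
           length bss # concat (map (\<lambda>bs. length bs # bs) bss))"

text \<open>
  The bit length of the input: \<open>floorlog 2 x\<close> is the number of binary digits of \<open>x\<close> (0 for
  \<open>x = 0\<close>), and one further bit per number accounts for delimiters.
\<close>

definition input_size :: "nat list \<Rightarrow> nat" where
  "input_size xs = (\<Sum>x\<leftarrow>xs. Suc (floorlog 2 x))"

end

theory Submission
  imports Defs
begin

text \<open>
  Instead of solving the LP relaxation, a perceptron-style iteration looks for vertex weights whose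
  rounding is good. Let \<open>T = |V| + 1\<close>, start from the weights \<open>x = 0\<close> and guess \<open>k = 0, 1, \<dots>, |V|\<close>.
  An edge both of whose endpoints have weight below \<open>T\<close> gets its endpoints incremented; a set in
  which more than \<open>2 k\<close> vertices have weight at least \<open>T\<close> gets its weights decremented, truncated
  at 0. Let \<open>H\<close> be an optimal cover, with indicator scaled by \<open>2 T\<close>. An edge update has
  \<open>x u + x v \<le> 2 T - 2\<close>, while \<open>H\<close> gives at least \<open>2 T\<close>; a set update has weight at least
  \<open>(2 k + 1) T\<close>, while \<open>H\<close> gives at most \<open>2 T k\<close> once \<open>k \<ge> k\<^sup>\<star>\<close>. So each update
  decreases the squared distance to \<open>H\<close> by at least 2. Weights never exceed \<open>T\<close>, hence this
  distance is below \<open>4 T\<^sup>3\<close> and \<open>2 T\<^sup>3\<close> passes suffice for \<open>k = k\<^sup>\<star>\<close>. When a pass changes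
  nothing, the vertices of weight at least \<open>T\<close> form a cover of sparseness at most \<open>2 k\<close>.
\<close>

section \<open>Total correctness with time bounds\<close>

text \<open>Asking for one run gives total correctness, since \<open>exec_deterministic\<close>
  makes it the only run. \<open>T\<close> is an upper bound, so costs can be rounded up.\<close>

definition wp :: "com \<Rightarrow> nat \<Rightarrow> (state \<Rightarrow> bool) \<Rightarrow> state \<Rightarrow> bool" where
  "wp c T Q s \<longleftrightarrow> (\<exists>t s'. exec c s t s' \<and> t \<le> T \<and> Q s')"

abbreviation upd :: "state \<Rightarrow> string \<Rightarrow> nat \<Rightarrow> nat \<Rightarrow> state" where
  "upd s x i v \<equiv> s(x := (s x)(i := v))"

lemma wp_mono:
  assumes "wp c T Q s" "T \<le> T'" "\<And>s'. Q s' \<Longrightarrow> Q' s'"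
  shows "wp c T' Q' s"
  using assms unfolding wp_def by (meson le_trans)

lemma wp_Seq:
  assumes "wp c1 T1 (wp c2 T2 Q) s" "T1 + T2 \<le> T"
  shows "wp (Seq c1 c2) T Q s"
proof -
  obtain t1 s1 t2 s2 where "exec c1 s t1 s1" "t1 \<le> T1" "exec c2 s1 t2 s2" "t2 \<le> T2" "Q s2"
    using assms(1) unfolding wp_def by blast
  then have "exec (Seq c1 c2) s (t1 + t2) s2" "t1 + t2 \<le> T" "Q s2"
    using assms(2) by (auto intro: exec.Seq)
  then show ?thesis unfolding wp_def by blast
qed

lemma wp_Skip: "1 \<le> T \<Longrightarrow> Q s \<Longrightarrow> wp Skip T Q s"
  unfolding wp_def using exec.Skip by blast

lemma wp_Write: "1 \<le> T \<Longrightarrow> Q (upd s x (aval a s) (aval b s)) \<Longrightarrow> wp (Write x a b) T Q s"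
  unfolding wp_def using exec.Write by blast

lemma wp_Write_Seq:
  assumes "1 \<le> T" "wp c (T - 1) Q (upd s x (aval a s) (aval b s))"
  shows "wp (Seq (Write x a b) c) T Q s"
  by (rule wp_Seq[of _ 1 _ "T - 1"]) (use assms in \<open>auto intro: wp_Write\<close>)

lemma wp_If:
  assumes "1 \<le> T" "aval a s \<noteq> 0 \<Longrightarrow> wp c1 (T - 1) Q s" "aval a s = 0 \<Longrightarrow> wp c2 (T - 1) Q s"
  shows "wp (If a c1 c2) T Q s"
proof (cases "aval a s = 0")
  case True
  then obtain t s' where "exec c2 s t s'" "t \<le> T - 1" "Q s'"
    using assms(3) unfolding wp_def by blast
  then have "exec (If a c1 c2) s (1 + t) s'" "1 + t \<le> T" "Q s'"
    using True assms(1) exec.IfFalse by auto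
  then show ?thesis unfolding wp_def by blast
next
  case False
  then obtain t s' where "exec c1 s t s'" "t \<le> T - 1" "Q s'"
    using assms(2) unfolding wp_def by blast
  then have "exec (If a c1 c2) s (1 + t) s'" "1 + t \<le> T" "Q s'"
    using False assms(1) exec.IfTrue by auto
  then show ?thesis unfolding wp_def by blast
qed

abbreviation Var :: "string \<Rightarrow> aexp" where
  "Var x \<equiv> Read x (Const 0)"

abbreviation Assign :: "string \<Rightarrow> aexp \<Rightarrow> com" where
  "Assign x a \<equiv> Write x (Const 0) a"

text \<open>Truncated subtraction serves as comparison: the guard is nonzero exactly while the
  counter is below \<open>a\<close>. As \<open>a\<close> is evaluated anew in each round, the rules
  below require the invariant to fix its value.\<close>

definition For :: "string \<Rightarrow> aexp \<Rightarrow> com \<Rightarrow> com" where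
  "For i a c = Seq (Assign i (Const 0))
     (While (Minus a (Var i)) (Seq c (Assign i (Plus (Var i) (Const 1)))))"

text \<open>Each round costs \<open>T\<close> for the body and one step each for guard and
  increment; the extra 1 is the failing guard.\<close>

lemma wp_While_count:
  assumes "I j s" "j \<le> n"
    and "\<And>j s. I j s \<Longrightarrow> aval a s = n \<and> s i 0 = j"
    and "\<And>j s. j < n \<Longrightarrow> I j s \<Longrightarrow> wp c T (\<lambda>s'. I (Suc j) (upd s' i 0 (Suc (s' i 0)))) s"
  shows "wp (While (Minus a (Var i)) (Seq c (Assign i (Plus (Var i) (Const 1)))))
           ((n - j) * (T + 2) + 1) (I n) s"
  using assms(1,2)
proof (induction "n - j" arbitrary: j s)
  case 0
  with assms(3)[OF 0(2)] have "exec (While (Minus a (Var i))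
      (Seq c (Assign i (Plus (Var i) (Const 1))))) s 1 s" "j = n"
    by (auto intro!: exec.WhileFalse[simplified])
  with 0 show ?case unfolding wp_def by auto
next
  case (Suc d)
  let ?b = "Seq c (Assign i (Plus (Var i) (Const 1)))"
  let ?w = "While (Minus a (Var i)) ?b"
  from Suc have "j < n" by simp
  then have "wp ?b (T + 1) (I (Suc j)) s"
    by (intro wp_Seq[of _ T _ 1] wp_mono[OF assms(4)[of j]])
      (auto intro: wp_Write simp: Suc.prems)
  then obtain t1 s1 where 1: "exec ?b s t1 s1" "t1 \<le> T + 1" "I (Suc j) s1"
    unfolding wp_def by blast
  have "wp ?w ((n - Suc j) * (T + 2) + 1) (I n) s1"
    using Suc.hyps(1)[of "Suc j" s1] Suc.hyps(2) \<open>j < n\<close> 1(3) by simp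
  then obtain t2 s2 where 2: "exec ?w s1 t2 s2" "t2 \<le> (n - Suc j) * (T + 2) + 1" "I n s2"
    unfolding wp_def by blast
  have "exec ?w s (1 + t1 + t2) s2"
    by (rule exec.WhileTrue[OF _ 1(1) 2(1)]) (use assms(3)[OF Suc.prems(1)] \<open>j < n\<close> in simp)
  moreover have "n - j = Suc (n - Suc j)" using \<open>j < n\<close> by simp
  then have "1 + t1 + t2 \<le> (n - j) * (T + 2) + 1" using 1(2) 2(2) by simp
  ultimately show ?case using 2(3) unfolding wp_def by blast
qed

text \<open>The time bound uses any \<open>m\<close> above the true count \<open>n\<close>, so that
  all loops can be charged to the input size.\<close>

lemma wp_For:
  assumes init: "I 0 (upd s i 0 0)"
    and cnt: "\<And>j s. I j s \<Longrightarrow> aval a s = n \<and> s i 0 = j"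
    and step: "\<And>j s. j < n \<Longrightarrow> I j s \<Longrightarrow> wp c T (\<lambda>s'. I (Suc j) (upd s' i 0 (Suc (s' i 0)))) s"
    and "n \<le> m" "m * (T + 2) + 2 \<le> T'"
    and post: "\<And>s. I n s \<Longrightarrow> Q s"
  shows "wp (For i a c) T' Q s"
proof -
  have "n * (T + 2) \<le> m * (T + 2)" using assms(4) by (rule mult_le_mono1)
  then have "wp (For i a c) T' (I n) s"
    unfolding For_def
    by (intro wp_Write_Seq wp_mono[OF wp_While_count[where I = I and j = 0 and n = n and T = T]])
      (use assms in auto)
  then show ?thesis by (rule wp_mono) (use post in auto)
qed


section \<open>The update rule\<close>

type_synonym wt = "(nat \<Rightarrow> nat) \<times> nat"

text \<open>The second component is a flag: nonzero when some constraint triggered an update.\<close>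

definition edge_step :: "nat \<Rightarrow> nat \<times> nat \<Rightarrow> wt \<Rightarrow> wt" where
  "edge_step T = (\<lambda>(u, v) (x, f). if x u < T \<and> x v < T
     then (let y = x(u := x u + 1) in y(v := y v + 1), 1) else (x, f))"

definition dec :: "nat \<Rightarrow> (nat \<Rightarrow> nat) \<Rightarrow> nat \<Rightarrow> nat" where
  "dec v x = x(v := x v - 1)"

definition set_step :: "nat \<Rightarrow> nat \<Rightarrow> nat list \<Rightarrow> wt \<Rightarrow> wt" where
  "set_step T k bs = (\<lambda>(x, f). if 2 * k < length (filter (\<lambda>v. T \<le> x v) bs)
     then (fold dec bs x, 1) else (x, f))"

text \<open>The flag is reset when a pass starts, so afterwards it tells whether this pass triggered
  an update. A clear flag freezes the weights, hence a fixed number of passes can be run without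
  leaving the loop early.\<close>

definition pass :: "nat \<Rightarrow> (nat \<times> nat) list \<Rightarrow> nat list list \<Rightarrow> nat \<Rightarrow> wt \<Rightarrow> wt" where
  "pass T es bss k = (\<lambda>(x, f). if f = 0 then (x, f)
     else fold (set_step T k) bss (fold (edge_step T) es (x, 0)))"

text \<open>Weights are carried over from one guess \<open>k\<close> to the next. The initial flag 1
  lets the first pass run.\<close>

definition cover_weights :: "nat \<Rightarrow> (nat \<times> nat) list \<Rightarrow> nat list list \<Rightarrow> wt" where
  "cover_weights T es bss = fold (\<lambda>k. pass T es bss k ^^ (2 * T ^ 3)) [0..<T] (\<lambda>_. 0, 1)"

lemma fold_dec:
  "distinct bs \<Longrightarrow> fold dec bs x = (\<lambda>v. if v \<in> set bs then x v - 1 else x v)"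
  by (induction bs arbitrary: x) (auto simp: dec_def fun_eq_iff)

section \<open>Squared distance to a scaled cover as potential\<close>

definition pot :: "nat \<Rightarrow> nat set \<Rightarrow> nat set \<Rightarrow> (nat \<Rightarrow> nat) \<Rightarrow> int" where
  "pot T V H x = (\<Sum>v\<in>V. (int (x v) - (if v \<in> H then 2 * int T else 0))\<^sup>2)"

text \<open>Write \<open>h\<close> for the target, \<open>2 * T\<close> on \<open>H\<close> and 0
  elsewhere. An increment at \<open>w\<close> adds \<open>2 * (x w - h w) + 1\<close>. Since
  \<open>x u + x v\<close> is at most \<open>2 * T - 2\<close> and \<open>h u + h v\<close> at least
  \<open>2 * T\<close>, the two increments add at most
  \<open>2 * (2 * T - 2) - 4 * T + 2 = - 2\<close>.\<close>

lemma pot_edge: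
  assumes "finite V" "u \<in> V" "v \<in> V" "u \<noteq> v" "u \<in> H \<or> v \<in> H" "x u < T" "x v < T"
  shows "pot T V H (x(u := x u + 1, v := x v + 1)) \<le> pot T V H x - 2"
proof -
  let ?y = "x(u := x u + 1, v := x v + 1)"
  let ?t = "\<lambda>x w. (int (x w) - (if w \<in> H then 2 * int T else 0))\<^sup>2"
  have split: "pot T V H z = ?t z u + ?t z v + (\<Sum>w\<in>V - {u} - {v}. ?t z w)" for z
    unfolding pot_def using assms(1-4) by (simp add: sum.remove[of V u] sum.remove[of "V - {u}" v])
  have "(\<Sum>w\<in>V - {u} - {v}. ?t ?y w) = (\<Sum>w\<in>V - {u} - {v}. ?t x w)"
    by (intro sum.cong) auto
  moreover have "?t ?y u + ?t ?y v \<le> ?t x u + ?t x v - 2"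
    using assms(4-7) by (auto simp: power2_eq_square algebra_simps)
  ultimately show ?thesis by (simp only: split)
qed

text \<open>Summed over \<open>B\<close>, the change is at most
  \<open>- 2 * T * (2 * k + 1) + 4 * T * k + card B\<close>. As \<open>card B\<close> is at most
  \<open>T - 1\<close>, this is at most \<open>- T - 1\<close>, hence at most
  \<open>- 2\<close>.\<close>

lemma pot_set:
  assumes fin: "finite V" and B: "B \<subseteq> V" and T: "T = card V + 1"
    and H: "card (H \<inter> B) \<le> k" and viol: "2 * k < card {v \<in> B. T \<le> x v}"
  shows "pot T V H (\<lambda>v. if v \<in> B then x v - 1 else x v) \<le> pot T V H x - 2"
proof -
  let ?y = "\<lambda>v. if v \<in> B then x v - 1 else x v"
  let ?h = "\<lambda>v. if v \<in> H then 2 * int T else 0"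
  let ?t = "\<lambda>x w. (int (x w) - ?h w)\<^sup>2"
  have finB: "finite B" using B fin by (rule finite_subset)
  have split: "pot T V H z = (\<Sum>w\<in>B. ?t z w) + (\<Sum>w\<in>V - B. ?t z w)" for z
    unfolding pot_def using sum.subset_diff[OF B fin] by (simp add: add.commute)
  have out: "(\<Sum>w\<in>V - B. ?t ?y w) = (\<Sum>w\<in>V - B. ?t x w)"
    by (intro sum.cong) auto
  \<comment> \<open>For \<open>x w = 0\<close> truncation leaves the term as it is, and the
    right-hand side only adds \<open>2 * ?h w + 1\<close>, which is positive.\<close>
  have "?t ?y w \<le> ?t x w - 2 * int (x w) + 2 * ?h w + 1" if "w \<in> B" for w
    using that by (cases "x w") (auto simp: power2_eq_square algebra_simps)
  then have "(\<Sum>w\<in>B. ?t ?y w) \<le> (\<Sum>w\<in>B. ?t x w - 2 * int (x w) + 2 * ?h w + 1)"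
    by (rule sum_mono)
  also have "\<dots> = (\<Sum>w\<in>B. ?t x w) - 2 * (\<Sum>w\<in>B. int (x w)) + 2 * (\<Sum>w\<in>B. ?h w) + int (card B)"
    by (simp add: sum.distrib sum_subtractf sum_distrib_left)
  finally have le: "(\<Sum>w\<in>B. ?t ?y w) \<le>
      (\<Sum>w\<in>B. ?t x w) - 2 * (\<Sum>w\<in>B. int (x w)) + 2 * (\<Sum>w\<in>B. ?h w) + int (card B)" .
  have "(\<Sum>w\<in>B. ?h w) = 2 * int T * int (card (H \<inter> B))"
    using finB by (simp add: sum.If_cases Int_commute)
  also have "\<dots> \<le> 2 * int T * int k" using H by (intro mult_left_mono) auto
  finally have h: "(\<Sum>w\<in>B. ?h w) \<le> 2 * int T * int k" .
  have "int T * (2 * int k + 1) \<le> int T * int (card {v \<in> B. T \<le> x v})"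
    using viol by (intro mult_left_mono) auto
  also have "\<dots> = (\<Sum>w\<in>{v \<in> B. T \<le> x v}. int T)" by simp
  also have "\<dots> \<le> (\<Sum>w\<in>{v \<in> B. T \<le> x v}. int (x w))" by (intro sum_mono) auto
  also have "\<dots> \<le> (\<Sum>w\<in>B. int (x w))" using finB by (intro sum_mono2) auto
  finally have "int T * (2 * int k + 1) \<le> (\<Sum>w\<in>B. int (x w))" .
  moreover have "int (card B) \<le> int T - 1" using card_mono[OF fin B] T by simp
  moreover have "1 \<le> int T" using T by simp
  moreover have "int T * (2 * int k + 1) = 2 * int T * int k + int T" by (simp add: algebra_simps)
  ultimately have "(\<Sum>w\<in>B. ?t ?y w) \<le> (\<Sum>w\<in>B. ?t x w) - 2"
    using le h by linarith
  then show ?thesis by (simp only: split out)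
qed

text \<open>Weights and targets both lie between 0 and \<open>2 * T\<close>, so each term is at most
  \<open>(2 * T)\<^sup>2\<close>. This bounds the potential at any moment, whatever earlier guesses
  did to the weights.\<close>

lemma pot_le:
  assumes "\<And>v. x v \<le> T"
  shows "pot T V H x \<le> int (card V) * (4 * (int T)\<^sup>2)"
  unfolding pot_def
proof (rule sum_bounded_above)
  fix v
  have "\<bar>int (x v) - (if v \<in> H then 2 * int T else 0)\<bar> \<le> \<bar>2 * int T\<bar>"
    using assms[of v] by auto
  then show "(int (x v) - (if v \<in> H then 2 * int T else 0))\<^sup>2 \<le> 4 * (int T)\<^sup>2"
    unfolding abs_le_square_iff by (simp add: power_mult_distrib)
qed

lemma pot_nonneg: "0 \<le> pot T V H x"
  unfolding pot_def by (intro sum_nonneg) auto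

text \<open>The potential is only controlled under \<open>D\<close>, instantiated with \<open>opt \<le> k\<close> below.\<close>

definition sound_step ::
  "nat \<Rightarrow> bool \<Rightarrow> ((nat \<Rightarrow> nat) \<Rightarrow> int) \<Rightarrow> ((nat \<Rightarrow> nat) \<Rightarrow> bool) \<Rightarrow> (wt \<Rightarrow> wt) \<Rightarrow> bool" where
  "sound_step T D P ok g \<longleftrightarrow> (\<forall>x f. (\<forall>v. x v \<le> T) \<longrightarrow>
     (ok x \<and> g (x, f) = (x, f) \<or>
      snd (g (x, f)) = 1 \<and> (\<forall>v. fst (g (x, f)) v \<le> T) \<and> (D \<longrightarrow> P (fst (g (x, f))) \<le> P x - 2)))"

text \<open>No step resets the flag. So a final 0 means that no step changed anything, and all
  conditions \<open>ok c\<close> hold for the same weights rather than each at its own moment of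
  testing. A flag newly set in the fold witnesses one drop by 2, and under \<open>D\<close> no step
  raises \<open>P\<close>.\<close>

lemma sound_fold:
  assumes "\<And>c. c \<in> set cs \<Longrightarrow> sound_step T D P (ok c) (g c)" "\<forall>v. x v \<le> T" "fold g cs (x, f) = (y, h)"
  shows "(\<forall>v. y v \<le> T) \<and> (h = 0 \<longrightarrow> f = 0 \<and> y = x \<and> (\<forall>c\<in>set cs. ok c x)) \<and>
    (D \<longrightarrow> P y \<le> P x \<and> (h \<noteq> 0 \<longrightarrow> f \<noteq> 0 \<or> P y \<le> P x - 2))"
  using assms
proof (induction cs arbitrary: x f)
  case Nil
  then show ?case by auto
next
  case (Cons c cs)
  obtain x1 f1 where 1: "g c (x, f) = (x1, f1)" by fastforce
  have c: "ok c x \<and> x1 = x \<and> f1 = f \<or> f1 = 1 \<and> (\<forall>v. x1 v \<le> T) \<and> (D \<longrightarrow> P x1 \<le> P x - 2)"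
    using Cons.prems(1)[of c] Cons.prems(2) 1 unfolding sound_step_def
    by (metis fst_conv list.set_intros(1) prod.inject snd_conv)
  then have "\<forall>v. x1 v \<le> T" using Cons.prems(2) by auto
  with Cons.IH[of x1 f1] Cons.prems 1 c show ?case by auto
qed

lemma sound_edge_step:
  assumes "finite V" "u \<in> V" "v \<in> V" "u \<noteq> v" "u \<in> H \<or> v \<in> H"
  shows "sound_step T D (pot T V H) (\<lambda>x. T \<le> x u \<or> T \<le> x v) (edge_step T (u, v))"
  unfolding sound_step_def edge_step_def using pot_edge[OF assms] assms(4)
  by (auto simp: not_le Suc_le_eq)

text \<open>Here \<open>D\<close> supplies the bound on \<open>H\<close> inside the set.
  Distinctness turns the count over the list into a cardinality and makes the successive decrements
  a simultaneous one.\<close>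

lemma sound_set_step:
  assumes "finite V" "set bs \<subseteq> V" "T = card V + 1" "distinct bs"
    and "D \<Longrightarrow> card (H \<inter> set bs) \<le> k"
  shows "sound_step T D (pot T V H) (\<lambda>x. card {v \<in> set bs. T \<le> x v} \<le> 2 * k) (set_step T k bs)"
proof -
  have "length (filter (\<lambda>v. T \<le> x v) bs) = card {v \<in> set bs. T \<le> x v}" for x
    using distinct_card[of "filter (\<lambda>v. T \<le> x v) bs"] assms(4) by simp
  then show ?thesis
    unfolding sound_step_def set_step_def fold_dec[OF assms(4)]
    using pot_set[OF assms(1-3) assms(5)] by (auto simp: not_le le_diff_conv le_SucI)
qed

section \<open>Convergence at the optimal guess\<close>

text \<open>Guesses below \<open>opt\<close> may fail, but they keep the weights bounded by
  \<open>T\<close>, and if one succeeds its result is good enough. The guess \<open>opt\<close>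
  cannot fail, so later guesses find a clear flag and change nothing. \<open>H\<close> occurs in the
  analysis only.\<close>

lemma cover_weights_correct:
  assumes fin: "finite V" and T: "T = card V + 1"
    and es: "\<And>u v. (u, v) \<in> set es \<Longrightarrow> u \<in> V \<and> v \<in> V \<and> u \<noteq> v \<and> (u \<in> H \<or> v \<in> H)"
    and bss: "\<And>bs. bs \<in> set bss \<Longrightarrow> set bs \<subseteq> V \<and> distinct bs \<and> card (H \<inter> set bs) \<le> opt"
    and opt: "opt < T"
    and res: "cover_weights T es bss = (x, f)"
  shows "(\<forall>(u, v)\<in>set es. T \<le> x u \<or> T \<le> x v) \<and>
    (\<forall>bs\<in>set bss. card {v \<in> set bs. T \<le> x v} \<le> 2 * opt)"
proof -
  define good where "good = (\<lambda>x. (\<forall>(u, v)\<in>set es. T \<le> x u \<or> T \<le> x v) \<and>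
    (\<forall>bs\<in>set bss. card {v \<in> set bs. T \<le> x v} \<le> 2 * opt))"
  define inv :: "wt \<Rightarrow> bool" where
    "inv = (\<lambda>(x, f). (\<forall>v. x v \<le> T) \<and> (f = 0 \<longrightarrow> good x))"
  let ?P = "pot T V H"
  have pass_done: "pass T es bss k (x, 0) = (x, 0)" for k x
    by (simp add: pass_def)
  \<comment> \<open>Both comparisons matter: \<open>k \<le> opt\<close> turns the bound
    \<open>2 * k\<close> into the \<open>2 * opt\<close> of \<open>good\<close>, while
    \<open>opt \<le> k\<close> makes the potential drop.\<close>
  have pass_inv: "inv (y, h) \<and> (opt \<le> k \<longrightarrow> h \<noteq> 0 \<longrightarrow> ?P y \<le> ?P x - 2)"
    if "inv (x, f)" "k \<le> opt" "f \<noteq> 0" "pass T es bss k (x, f) = (y, h)" for x f y h k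
  proof -
    obtain x1 f1 where 1: "fold (edge_step T) es (x, 0) = (x1, f1)" by fastforce
    with that have 2: "fold (set_step T k) bss (x1, f1) = (y, h)" by (simp add: pass_def)
    have b: "\<forall>v. x v \<le> T" using that by (simp add: inv_def)
    have se: "sound_step T (opt \<le> k) ?P (\<lambda>x. T \<le> x (fst e) \<or> T \<le> x (snd e)) (edge_step T e)"
      if "e \<in> set es" for e
      using es[of "fst e" "snd e"] that sound_edge_step[OF fin, of "fst e" "snd e" H] by simp
    have e: "(\<forall>v. x1 v \<le> T) \<and>
      (f1 = 0 \<longrightarrow> (0 :: nat) = 0 \<and> x1 = x \<and> (\<forall>e\<in>set es. T \<le> x (fst e) \<or> T \<le> x (snd e))) \<and>
      (opt \<le> k \<longrightarrow> ?P x1 \<le> ?P x \<and> (f1 \<noteq> 0 \<longrightarrow> (0 :: nat) \<noteq> 0 \<or> ?P x1 \<le> ?P x - 2))"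
      by (rule sound_fold[OF se b 1])
    have s: "(\<forall>v. y v \<le> T) \<and>
      (h = 0 \<longrightarrow> f1 = 0 \<and> y = x1 \<and> (\<forall>bs\<in>set bss. card {v \<in> set bs. T \<le> x1 v} \<le> 2 * k)) \<and>
      (opt \<le> k \<longrightarrow> ?P y \<le> ?P x1 \<and> (h \<noteq> 0 \<longrightarrow> f1 \<noteq> 0 \<or> ?P y \<le> ?P x1 - 2))"
      by (rule sound_fold[OF _ _ 2])
        (use e bss in \<open>auto intro!: sound_set_step[OF fin _ T] intro: le_trans\<close>)
    show ?thesis using e s that(2) unfolding inv_def good_def by fastforce
  qed
  have iter: "inv (y, h) \<and> (f = 0 \<longrightarrow> h = 0) \<and>
      (opt \<le> k \<longrightarrow> h \<noteq> 0 \<longrightarrow> ?P y + 2 * int i \<le> ?P x)"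
    if "inv (x, f)" "f = 0 \<or> k \<le> opt" "(pass T es bss k ^^ i) (x, f) = (y, h)" for x f y h k i
    using that(3)
  proof (induction i arbitrary: y h)
    case 0
    then show ?case using that(1) by auto
  next
    case (Suc i)
    obtain y1 h1 where 1: "(pass T es bss k ^^ i) (x, f) = (y1, h1)" by fastforce
    with Suc.prems have 2: "pass T es bss k (y1, h1) = (y, h)" by simp
    note IH = Suc.IH[OF 1]
    show ?case
    proof (cases "h1 = 0")
      case True
      then show ?thesis using IH 2 pass_done[of k y1] by auto
    next
      case False
      then have "k \<le> opt" using IH that(2) by auto
      with pass_inv[OF _ _ False 2] IH False show ?thesis by auto
    qed
  qed
  have outer: "inv (y, h) \<and> (opt < j \<longrightarrow> h = 0)"
    if "fold (\<lambda>k. pass T es bss k ^^ (2 * T ^ 3)) [0..<j] (\<lambda>_. 0, 1) = (y, h)" for j y h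
    using that
  proof (induction j arbitrary: y h)
    case 0
    then show ?case by (auto simp: inv_def)
  next
    case (Suc j)
    obtain y1 h1 where 1: "fold (\<lambda>k. pass T es bss k ^^ (2 * T ^ 3)) [0..<j] (\<lambda>_. 0, 1) = (y1, h1)"
      by fastforce
    with Suc.prems have 2: "(pass T es bss j ^^ (2 * T ^ 3)) (y1, h1) = (y, h)" by simp
    note IH = Suc.IH[OF 1]
    then have it: "inv (y, h) \<and> (h1 = 0 \<longrightarrow> h = 0) \<and>
        (opt \<le> j \<longrightarrow> h \<noteq> 0 \<longrightarrow> ?P y + 2 * int (2 * T ^ 3) \<le> ?P y1)"
      by (intro iter[OF _ _ 2]) auto
    \<comment> \<open>If the flag survived, \<open>2 * T ^ 3\<close> passes would have lowered the
      potential by \<open>4 * T ^ 3\<close>, more than \<open>pot_le\<close> allows because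
      \<open>card V < T\<close>.\<close>
    have "h = 0" if "opt = j"
    proof (rule ccontr)
      assume "h \<noteq> 0"
      then have "4 * int T ^ 3 \<le> ?P y1" using it that pot_nonneg[of T V H y] by simp
      also have "\<dots> \<le> int (card V) * (4 * (int T)\<^sup>2)" using IH by (intro pot_le) (auto simp: inv_def)
      also have "\<dots> < int T * (4 * (int T)\<^sup>2)" using T by (intro mult_strict_right_mono) auto
      finally show False by (simp add: power2_eq_square power3_eq_cube)
    qed
    then show ?case using it IH by (auto simp: less_Suc_eq)
  qed
  from outer[of T x f] res opt show ?thesis by (auto simp: cover_weights_def inv_def good_def)
qed


section \<open>The program\<close>

abbreviation "aT \<equiv> Var ''T''"
text \<open>Entry \<open>T\<close> of the input is the number of edges, so edge \<open>j\<close>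
  occupies entries \<open>T + 1 + 2 * j\<close> and \<open>T + 2 + 2 * j\<close>. Doubling is done
  by addition.\<close>

abbreviation "endpoint d \<equiv>
  Read ''in'' (Plus (Plus aT (Const d)) (Plus (Var ''j'') (Var ''j'')))"
abbreviation "elem \<equiv> Read ''in'' (Plus (Plus (Var ''p'') (Const 1)) (Var ''e''))"
abbreviation "weight a \<equiv> Read ''x'' a"

definition edge_body :: com where
  "edge_body = If (Minus aT (weight (endpoint 1))) (If (Minus aT (weight (endpoint 2)))
     (Seq (Write ''x'' (endpoint 1) (Plus (weight (endpoint 1)) (Const 1)))
     (Seq (Write ''x'' (endpoint 2) (Plus (weight (endpoint 2)) (Const 1)))
       (Assign ''f'' (Const 1)))) Skip) Skip"

definition edge_loop :: com where
  "edge_loop = For ''j'' (Var ''m'') edge_body"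

text \<open>The guard \<open>x + 1 - T\<close> is nonzero exactly when the weight is at least
  \<open>T\<close>.\<close>

definition count_loop :: com where
  "count_loop = For ''e'' (Var ''l'') (If (Minus (Plus (weight elem) (Const 1)) aT)
     (Assign ''c'' (Plus (Var ''c'') (Const 1))) Skip)"

definition dec_loop :: com where
  "dec_loop = For ''e'' (Var ''l'') (Write ''x'' elem (Minus (weight elem) (Const 1)))"

text \<open>The sets have varying lengths, so \<open>''p''\<close> walks along their length entries
  instead of being computed from the index \<open>''b''\<close>.\<close>

definition set_body :: com where
  "set_body = Seq (Assign ''l'' (Read ''in'' (Var ''p''))) (Seq (Assign ''c'' (Const 0)) (Seq count_loop
     (Seq (If (Minus (Var ''c'') (Plus (Var ''k'') (Var ''k'')))
             (Seq (Assign ''f'' (Const 1)) dec_loop) Skip)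
       (Assign ''p'' (Plus (Plus (Var ''p'') (Const 1)) (Var ''l''))))))"

definition set_loop :: com where
  "set_loop = Seq (Assign ''p'' (Plus (Plus aT (Const 2)) (Plus (Var ''m'') (Var ''m''))))
     (For ''b'' (Read ''in'' (Plus (Plus aT (Const 1)) (Plus (Var ''m'') (Var ''m'')))) set_body)"

definition pass_prog :: com where
  "pass_prog = If (Var ''f'') (Seq (Assign ''f'' (Const 0)) (Seq edge_loop set_loop)) Skip"

definition main_loop :: com where
  "main_loop = For ''k'' aT (For ''i'' (Var ''N'') pass_prog)"

text \<open>In the absence of multiplication, two loops of additions form \<open>T * T\<close> and
  then \<open>T * (T * T)\<close>; they rely on memory outside the input being 0.\<close>

definition init_prog :: com where
  "init_prog = Seq (Assign ''T'' (Plus (Read ''in'' (Const 0)) (Const 1)))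
     (Seq (Assign ''m'' (Read ''in'' aT))
     (Seq (For ''i'' aT (Assign ''q'' (Plus (Var ''q'') aT)))
     (Seq (For ''i'' aT (Assign ''r'' (Plus (Var ''r'') (Var ''q''))))
     (Seq (Assign ''N'' (Plus (Var ''r'') (Var ''r''))) (Assign ''f'' (Const 1))))))"

abbreviation "vertex \<equiv> Read ''in'' (Plus (Var ''i'') (Const 1))"

definition output_loop :: com where
  "output_loop = For ''i'' (Read ''in'' (Const 0))
     (If (Minus (Plus (weight vertex) (Const 1)) aT)
       (Seq (Assign ''out'' (Plus (Var ''out'') (Const 1))) (Write ''out'' (Var ''out'') vertex)) Skip)"

definition cover_prog :: com where
  "cover_prog = Seq init_prog (Seq main_loop output_loop)"

section \<open>Addresses of the parts of the input\<close>

lemma input_nth: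
  "i < length ys \<Longrightarrow> initial_state (pre @ ys @ post) ''in'' (length pre + i) = ys ! i"
  by (simp add: initial_state_def nth_append)

lemma input_concat_nth:
  assumes "j < length ys" "i < length (g (ys ! j))"
  shows "initial_state (pre @ concat (map g ys) @ post) ''in''
    (length pre + length (concat (map g (take j ys))) + i) = g (ys ! j) ! i"
proof -
  have "concat (map g ys) = concat (map g (take j ys)) @ g (ys ! j) @ concat (map g (drop (Suc j) ys))"
    by (subst id_take_nth_drop[OF assms(1)]) simp
  then show ?thesis
    using input_nth[OF assms(2), of "pre @ concat (map g (take j ys))" "concat (map g (drop (Suc j) ys)) @ post"]
    by simp
qed

lemma length_concat_pairs: "length (concat (map (\<lambda>(u, v). [u, v]) es)) = 2 * length es"
  by (induction es) auto

lemma length_concat_ge: "y \<in> set ys \<Longrightarrow> length (g y) \<le> length (concat (map g ys))"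
  by (induction ys) auto

text \<open>Meant for the blocks of the family: even an empty set occupies its length entry, so the
  number of sets is at most the input length.\<close>

lemma length_le_concat: "(\<And>y. g y \<noteq> []) \<Longrightarrow> length ys \<le> length (concat (map g ys))"
proof (induction ys)
  case (Cons y ys)
  have "1 \<le> length (g y)" using Cons.prems[of y] by (simp add: Suc_le_eq)
  moreover have "length ys \<le> length (concat (map g ys))" using Cons by blast
  ultimately show ?case unfolding list.map concat.simps length_append list.size(4) by linarith
qed simp

definition listing :: "nat list \<Rightarrow> (nat \<times> nat) list \<Rightarrow> nat list list \<Rightarrow> nat list" where
  "listing vs es bss = length vs # vs @
     length es # concat (map (\<lambda>(u, v). [u, v]) es) @
     length bss # concat (map (\<lambda>bs. length bs # bs) bss)"

text \<open>\<open>S\<close> is kept apart from the length so that it can become the bit size of the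
  input.\<close>

locale run =
  fixes vs :: "nat list" and es :: "(nat \<times> nat) list" and bss :: "nat list list" and S :: nat
  assumes size: "length (listing vs es bss) \<le> S"
begin

definition T :: nat where "T = length vs + 1"

text \<open>The address of the length entry of set number \<open>b\<close>.\<close>

definition off :: "nat \<Rightarrow> nat" where
  "off b = T + 2 + 2 * length es + length (concat (map (\<lambda>bs. length bs # bs) (take b bss)))"

abbreviation inp :: "nat \<Rightarrow> nat" where
  "inp \<equiv> initial_state (listing vs es bss) ''in''"

lemma inp_0: "inp 0 = length vs"
  by (simp add: initial_state_def listing_def)

lemma inp_vertex: "i < length vs \<Longrightarrow> inp (Suc i) = vs ! i"
  using input_nth[of i vs "[length vs]"] by (simp add: listing_def)

lemma inp_T: "inp T = length es"
  using input_nth[of 0 "[length es]" "length vs # vs"] by (simp add: listing_def T_def)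

lemma inp_edge:
  assumes "j < length es" "es ! j = (u, v)"
  shows "inp (Suc (T + (j + j))) = u" "inp (Suc (Suc (T + (j + j)))) = v"
  using input_concat_nth[OF assms(1), of 0 "\<lambda>(u, v). [u, v]" "length vs # vs @ [length es]"]
    input_concat_nth[OF assms(1), of 1 "\<lambda>(u, v). [u, v]" "length vs # vs @ [length es]"]
    assms length_concat_pairs[of "take j es"]
  by (simp_all add: listing_def T_def mult_2)

lemma inp_sets: "inp (Suc (T + (length es + length es))) = length bss"
  using input_nth[of 0 "[length bss]" "length vs # vs @ length es # concat (map (\<lambda>(u, v). [u, v]) es)"]
    length_concat_pairs[of es]
  by (simp add: listing_def T_def mult_2)

lemma off_0: "off 0 = Suc (Suc (T + (length es + length es)))"
  by (simp add: off_def)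

lemma off_Suc: "b < length bss \<Longrightarrow> off (Suc b) = Suc (off b + length (bss ! b))"
  by (simp add: off_def take_Suc_conv_app_nth)

lemma inp_set:
  assumes "b < length bss" "i < Suc (length (bss ! b))"
  shows "inp (off b + i) = (length (bss ! b) # bss ! b) ! i"
proof -
  let ?pre = "length vs # vs @ length es # concat (map (\<lambda>(u, v). [u, v]) es) @ [length bss]"
  have "listing vs es bss = ?pre @ concat (map (\<lambda>bs. length bs # bs) bss) @ []"
    by (simp add: listing_def)
  moreover have "off b = length ?pre + length (concat (map (\<lambda>bs. length bs # bs) (take b bss)))"
    using length_concat_pairs[of es] by (simp add: off_def T_def)
  ultimately show ?thesis
    using input_concat_nth[OF assms(1), of i "\<lambda>bs. length bs # bs" ?pre "[]"] assms(2) by simp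
qed

lemma inp_set_length: "b < length bss \<Longrightarrow> inp (off b) = length (bss ! b)"
  using inp_set[of b 0] by simp

lemma inp_set_elem: "b < length bss \<Longrightarrow> i < length (bss ! b) \<Longrightarrow> inp (Suc (off b + i)) = bss ! b ! i"
  using inp_set[of b "Suc i"] by simp

lemma T_le: "T \<le> S"
  using size by (simp add: listing_def T_def)

lemma edges_le: "length es \<le> S"
  using size length_concat_pairs[of es] by (simp add: listing_def)

lemma sets_le: "length bss \<le> S"
  using size length_le_concat[of "\<lambda>bs. length bs # bs" bss] by (simp add: listing_def)

lemma set_le: "b < length bss \<Longrightarrow> length (bss ! b) \<le> S"
  using size length_concat_ge[of "bss ! b" bss "\<lambda>bs. length bs # bs"] by (simp add: listing_def)

section \<open>Simulation of the update rule by the program\<close>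

text \<open>Couples the memory with the abstract pair \<open>z\<close> of weights and flag. The
  clause on \<open>''out''\<close> ensures that the output loop starts from the empty list.\<close>

definition st :: "nat \<Rightarrow> nat \<Rightarrow> wt \<Rightarrow> state \<Rightarrow> bool" where
  "st k i z s \<longleftrightarrow> s ''in'' = inp \<and> s ''T'' 0 = T \<and> s ''m'' 0 = length es \<and>
     s ''N'' 0 = 2 * T ^ 3 \<and> s ''out'' 0 = 0 \<and> s ''k'' 0 = k \<and> s ''i'' 0 = i \<and>
     s ''x'' = fst z \<and> s ''f'' 0 = snd z"

lemma wp_edge_loop:
  assumes "st k i z s"
  shows "wp edge_loop (S * 7 + 2) (st k i (fold (edge_step T) es z)) s"
  unfolding edge_loop_def
\<comment> \<open>Five steps: two guards and three writes.\<close>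
proof (rule wp_For[where n = "length es" and T = 5 and m = S and
      I = "\<lambda>j s. st k i (fold (edge_step T) (take j es) z) s \<and> s ''j'' 0 = j"])
  fix j s
  assume j: "j < length es" and I: "st k i (fold (edge_step T) (take j es) z) s \<and> s ''j'' 0 = j"
  obtain u v where uv: "es ! j = (u, v)" by fastforce
  obtain x f where xf: "fold (edge_step T) (take j es) z = (x, f)" by fastforce
  show "wp edge_body 5 (\<lambda>s'. st k i (fold (edge_step T) (take (Suc j) es) z) (upd s' ''j'' 0 (Suc (s' ''j'' 0)))
      \<and> upd s' ''j'' 0 (Suc (s' ''j'' 0)) ''j'' 0 = Suc j) s"
    unfolding edge_body_def using I xf j uv inp_edge[OF j uv]
    by (intro wp_If wp_Write_Seq wp_Write wp_Skip)
      (auto simp: st_def take_Suc_conv_app_nth edge_step_def Let_def)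
qed (use assms edges_le in \<open>auto simp: st_def\<close>)

definition in_set :: "nat \<Rightarrow> nat \<Rightarrow> wt \<Rightarrow> nat \<Rightarrow> nat \<Rightarrow> state \<Rightarrow> bool" where
  "in_set k i z b c s \<longleftrightarrow> st k i z s \<and> s ''b'' 0 = b \<and> s ''p'' 0 = off b \<and>
     s ''l'' 0 = length (bss ! b) \<and> s ''c'' 0 = c"

lemma wp_count_loop:
  assumes "in_set k i z b 0 s" "b < length bss"
  shows "wp count_loop (S * 4 + 2)
    (in_set k i z b (length (filter (\<lambda>v. T \<le> fst z v) (bss ! b)))) s"
  unfolding count_loop_def
proof (rule wp_For[where n = "length (bss ! b)" and T = 2 and m = S and
      I = "\<lambda>e s. in_set k i z b (length (filter (\<lambda>v. T \<le> fst z v) (take e (bss ! b)))) s \<and> s ''e'' 0 = e"])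
  fix e s
  assume e: "e < length (bss ! b)" and
    I: "in_set k i z b (length (filter (\<lambda>v. T \<le> fst z v) (take e (bss ! b)))) s \<and> s ''e'' 0 = e"
  show "wp (If (Minus (Plus (weight elem) (Const 1)) aT) (Assign ''c'' (Plus (Var ''c'') (Const 1))) Skip) 2
      (\<lambda>s'. in_set k i z b (length (filter (\<lambda>v. T \<le> fst z v) (take (Suc e) (bss ! b))))
         (upd s' ''e'' 0 (Suc (s' ''e'' 0))) \<and> upd s' ''e'' 0 (Suc (s' ''e'' 0)) ''e'' 0 = Suc e) s"
    using I e inp_set_elem[OF assms(2) e]
    by (intro wp_If wp_Write wp_Skip) (auto simp: st_def in_set_def take_Suc_conv_app_nth)
qed (use assms set_le in \<open>auto simp: st_def in_set_def\<close>)

lemma wp_dec_loop: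
  assumes "in_set k i (x, f) b c s" "b < length bss"
  shows "wp dec_loop (S * 3 + 2) (in_set k i (fold dec (bss ! b) x, f) b c) s"
  unfolding dec_loop_def
proof (rule wp_For[where n = "length (bss ! b)" and T = 1 and m = S and
      I = "\<lambda>e s. in_set k i (fold dec (take e (bss ! b)) x, f) b c s \<and> s ''e'' 0 = e"])
  fix e s
  assume e: "e < length (bss ! b)" and
    I: "in_set k i (fold dec (take e (bss ! b)) x, f) b c s \<and> s ''e'' 0 = e"
  show "wp (Write ''x'' elem (Minus (weight elem) (Const 1))) 1
      (\<lambda>s'. in_set k i (fold dec (take (Suc e) (bss ! b)) x, f) b c
         (upd s' ''e'' 0 (Suc (s' ''e'' 0))) \<and> upd s' ''e'' 0 (Suc (s' ''e'' 0)) ''e'' 0 = Suc e) s"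
    using I e inp_set_elem[OF assms(2) e]
    by (intro wp_Write) (auto simp: st_def in_set_def take_Suc_conv_app_nth dec_def)
qed (use assms set_le in \<open>auto simp: st_def in_set_def\<close>)

text \<open>\<open>S * 7\<close> is made up of \<open>S * 4\<close> for counting and
  \<open>S * 3\<close> for decrementing.\<close>

lemma wp_set_body:
  assumes "st k i z s" "s ''b'' 0 = b" "s ''p'' 0 = off b" "b < length bss"
  shows "wp set_body (S * 7 + 10) (\<lambda>s. st k i (set_step T k (bss ! b) z) s \<and>
    s ''b'' 0 = b \<and> s ''p'' 0 = off (Suc b)) s"
proof -
  obtain x f where z: "z = (x, f)" by fastforce
  let ?c = "length (filter (\<lambda>v. T \<le> x v) (bss ! b))"
  let ?Q = "in_set k i (set_step T k (bss ! b) z) b ?c"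
  have post: "wp (Assign ''p'' (Plus (Plus (Var ''p'') (Const 1)) (Var ''l''))) 1
      (\<lambda>s. st k i (set_step T k (bss ! b) z) s \<and> s ''b'' 0 = b \<and> s ''p'' 0 = off (Suc b)) s"
    if "?Q s" for s
    using that off_Suc[OF assms(4)] by (intro wp_Write) (auto simp: in_set_def st_def)
  have test: "wp (If (Minus (Var ''c'') (Plus (Var ''k'') (Var ''k'')))
        (Seq (Assign ''f'' (Const 1)) dec_loop) Skip) (S * 3 + 4) ?Q s"
    if s: "in_set k i z b ?c s" for s
  proof (rule wp_If)
    assume *: "aval (Minus (Var ''c'') (Plus (Var ''k'') (Var ''k''))) s \<noteq> 0"
    have "wp dec_loop (S * 3 + 2) (in_set k i (fold dec (bss ! b) x, 1) b ?c) (upd s ''f'' 0 1)"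
      using s assms(4) by (intro wp_dec_loop) (auto simp: in_set_def st_def z)
    moreover have "set_step T k (bss ! b) z = (fold dec (bss ! b) x, 1)"
      using s * by (auto simp: set_step_def in_set_def st_def z)
    ultimately show "wp (Seq (Assign ''f'' (Const 1)) dec_loop) (S * 3 + 4 - 1) ?Q s"
      by (intro wp_Write_Seq) auto
  next
    assume "aval (Minus (Var ''c'') (Plus (Var ''k'') (Var ''k''))) s = 0"
    then have "set_step T k (bss ! b) z = z"
      using s by (auto simp: set_step_def in_set_def st_def z)
    then show "wp Skip (S * 3 + 4 - 1) ?Q s" using s by (intro wp_Skip) auto
  qed simp
  have count: "wp count_loop (S * 4 + 2) (in_set k i z b ?c) s" if "in_set k i z b 0 s" for s
    using wp_count_loop[OF that assms(4)] by (simp add: z)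
  have "in_set k i z b 0 (upd (upd s ''l'' 0 (length (bss ! b))) ''c'' 0 0)"
    using assms by (auto simp: in_set_def st_def)
  then show ?thesis
    unfolding set_body_def using inp_set_length[OF assms(4)] assms(1,3)
    by (intro wp_Write_Seq wp_Seq[of _ "S * 4 + 2" _ "S * 3 + 5"] wp_mono[OF count]
        wp_Seq[of _ "S * 3 + 4" _ 1] wp_mono[OF test] post) (auto simp: st_def)
qed

lemma wp_set_loop:
  assumes "st k i z s"
  shows "wp set_loop (S * (S * 7 + 12) + 3) (st k i (fold (set_step T k) bss z)) s"
  unfolding set_loop_def
proof (rule wp_Write_Seq)
  let ?s = "upd s ''p'' (aval (Const 0) s) (aval (Plus (Plus aT (Const 2)) (Plus (Var ''m'') (Var ''m''))) s)"
  show "wp (For ''b'' (Read ''in'' (Plus (Plus aT (Const 1)) (Plus (Var ''m'') (Var ''m'')))) set_body)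
      (S * (S * 7 + 12) + 3 - 1) (st k i (fold (set_step T k) bss z)) ?s"
  proof (rule wp_For[where n = "length bss" and T = "S * 7 + 10" and m = S and
        I = "\<lambda>b s. st k i (fold (set_step T k) (take b bss) z) s \<and> s ''b'' 0 = b \<and> s ''p'' 0 = off b"])
    fix b s
    assume b: "b < length bss" and
      I: "st k i (fold (set_step T k) (take b bss) z) s \<and> s ''b'' 0 = b \<and> s ''p'' 0 = off b"
    show "wp set_body (S * 7 + 10) (\<lambda>s'. st k i (fold (set_step T k) (take (Suc b) bss) z)
          (upd s' ''b'' 0 (Suc (s' ''b'' 0))) \<and> upd s' ''b'' 0 (Suc (s' ''b'' 0)) ''b'' 0 = Suc b \<and>
        upd s' ''b'' 0 (Suc (s' ''b'' 0)) ''p'' 0 = off (Suc b)) s"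
      using I b by (intro wp_mono[OF wp_set_body[of k i _ s b]])
        (auto simp: st_def take_Suc_conv_app_nth)
  qed (use assms sets_le inp_sets off_0 in \<open>auto simp: st_def\<close>)
qed simp

definition pass_time :: nat where
  "pass_time = S * 7 + S * (S * 7 + 12) + 7"

lemma wp_pass:
  assumes "st k i z s"
  shows "wp pass_prog pass_time (st k i (pass T es bss k z)) s"
  unfolding pass_prog_def
proof (rule wp_If)
  assume *: "aval (Var ''f'') s \<noteq> 0"
  obtain x f where z: "z = (x, f)" by fastforce
  have "st k i (x, 0) (upd s ''f'' 0 0)" using assms by (auto simp: st_def z)
  moreover have "pass T es bss k z = fold (set_step T k) bss (fold (edge_step T) es (x, 0))"
    using * assms by (auto simp: st_def z pass_def)
  moreover have "wp (Seq edge_loop set_loop) (S * 7 + 2 + (S * (S * 7 + 12) + 3))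
      (st k i (fold (set_step T k) bss (fold (edge_step T) es y))) s" if "st k i y s" for y s
    by (rule wp_Seq[OF wp_mono[OF wp_edge_loop[OF that] order_refl wp_set_loop]]) auto
  ultimately have "wp (Seq edge_loop set_loop) (S * 7 + 2 + (S * (S * 7 + 12) + 3))
      (st k i (pass T es bss k z)) (upd s ''f'' 0 0)" by simp
  then show "wp (Seq (Assign ''f'' (Const 0)) (Seq edge_loop set_loop)) (pass_time - 1)
      (st k i (pass T es bss k z)) s"
    by (intro wp_Write_Seq) (auto simp: pass_time_def elim!: wp_mono)
next
  assume "aval (Var ''f'') s = 0"
  then show "wp Skip (pass_time - 1) (st k i (pass T es bss k z)) s"
    using assms by (intro wp_Skip) (auto simp: pass_time_def st_def pass_def split: prod.split)
qed (simp add: pass_time_def)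

definition main_time :: nat where
  "main_time = S * (2 * S ^ 3 * (pass_time + 2) + 4) + 2"

lemma cube_le: "T ^ 3 \<le> S ^ 3"
  using T_le by (rule power_mono) simp

text \<open>The counter \<open>i\<close> is hidden by a quantifier, since every inner loop leaves it
  at its own final value.\<close>

lemma wp_main_loop:
  assumes "st 0 i (\<lambda>_. 0, 1) s"
  shows "wp main_loop main_time (\<lambda>s. \<exists>k i. st k i (cover_weights T es bss) s) s"
  unfolding main_loop_def
proof (rule wp_For[where n = T and T = "2 * S ^ 3 * (pass_time + 2) + 2" and m = S and
    I = "\<lambda>k s. \<exists>i. st k i (fold (\<lambda>k. pass T es bss k ^^ (2 * T ^ 3)) [0..<k] (\<lambda>_. 0, 1)) s"])
  fix k s
  let ?z = "fold (\<lambda>k. pass T es bss k ^^ (2 * T ^ 3)) [0..<k] (\<lambda>_. 0, 1)"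
  assume "\<exists>i. st k i ?z s"
  then obtain i where I: "st k i ?z s" ..
  show "wp (For ''i'' (Var ''N'') pass_prog) (2 * S ^ 3 * (pass_time + 2) + 2)
      (\<lambda>s'. \<exists>i. st (Suc k) i (fold (\<lambda>k. pass T es bss k ^^ (2 * T ^ 3)) [0..<Suc k] (\<lambda>_. 0, 1))
         (upd s' ''k'' 0 (Suc (s' ''k'' 0)))) s"
  proof (rule wp_For[where n = "2 * T ^ 3" and T = pass_time and m = "2 * S ^ 3" and
        I = "\<lambda>i s. st k i ((pass T es bss k ^^ i) ?z) s"])
    fix i s
    assume "st k i ((pass T es bss k ^^ i) ?z) s"
    from wp_pass[OF this]
    show "wp pass_prog pass_time
        (\<lambda>s'. st k (Suc i) ((pass T es bss k ^^ Suc i) ?z) (upd s' ''i'' 0 (Suc (s' ''i'' 0)))) s"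
      by (rule wp_mono) (auto simp: st_def)
  qed (use I cube_le in \<open>auto simp: st_def\<close>)
next
  show "S * (2 * S ^ 3 * (pass_time + 2) + 2 + 2) + 2 \<le> main_time"
    by (simp only: main_time_def add.assoc numeral_plus_numeral) simp
qed (use assms T_le in \<open>auto simp: st_def cover_weights_def\<close>)

lemma wp_init:
  "wp init_prog (S * 6 + 8) (st 0 T (\<lambda>_. 0, 1)) (initial_state (listing vs es bss))"
proof -
  let ?base = "\<lambda>s. s ''in'' = inp \<and> s ''T'' 0 = T \<and> s ''m'' 0 = length es \<and>
     s ''out'' 0 = 0 \<and> s ''k'' 0 = 0 \<and> s ''x'' = (\<lambda>_. 0)"
  have sq: "wp (For ''i'' aT (Assign ''q'' (Plus (Var ''q'') aT))) (S * 3 + 2)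
      (\<lambda>s. ?base s \<and> s ''q'' 0 = T * T \<and> s ''r'' 0 = 0) s"
    if "?base s" "s ''q'' 0 = 0" "s ''r'' 0 = 0" for s
    by (rule wp_For[where n = T and T = 1 and m = S and
      I = "\<lambda>i s. ?base s \<and> s ''q'' 0 = i * T \<and> s ''r'' 0 = 0 \<and> s ''i'' 0 = i"])
      (use that T_le in \<open>auto intro!: wp_Write\<close>)
  have cb: "wp (For ''i'' aT (Assign ''r'' (Plus (Var ''r'') (Var ''q'')))) (S * 3 + 2)
      (\<lambda>s. ?base s \<and> s ''r'' 0 = T * (T * T) \<and> s ''i'' 0 = T) s"
    if "?base s \<and> s ''q'' 0 = T * T \<and> s ''r'' 0 = 0" for s
    by (rule wp_For[where n = T and T = 1 and m = S and
      I = "\<lambda>i s. ?base s \<and> s ''q'' 0 = T * T \<and> s ''r'' 0 = i * (T * T) \<and> s ''i'' 0 = i"])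
      (use that T_le in \<open>auto intro!: wp_Write\<close>)
  have fin: "wp (Seq (Assign ''N'' (Plus (Var ''r'') (Var ''r''))) (Assign ''f'' (Const 1))) 2
      (st 0 T (\<lambda>_. 0, 1)) s"
    if "?base s \<and> s ''r'' 0 = T * (T * T) \<and> s ''i'' 0 = T" for s
    using that by (intro wp_Write_Seq wp_Write) (auto simp: st_def power3_eq_cube mult_2)
  have zero: "initial_state (listing vs es bss) y = (\<lambda>_. 0)" if "y \<noteq> ''in''" for y
    using that by (auto simp: initial_state_def)
  show ?thesis
    unfolding init_prog_def
    by (intro wp_Write_Seq wp_Seq[OF wp_mono[OF sq order_refl wp_Seq[OF wp_mono[OF cb order_refl fin]]]])
      (use inp_0 inp_T in \<open>auto simp: zero T_def\<close>)
qed

lemma wp_output_loop: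
  assumes "st k i (x, f) s"
  shows "wp output_loop (S * 5 + 2) (\<lambda>s. output_list s = filter (\<lambda>v. T \<le> x v) vs) s"
  unfolding output_loop_def
proof (rule wp_For[where n = "length vs" and T = 3 and m = S and
    I = "\<lambda>i s. s ''in'' = inp \<and> s ''T'' 0 = T \<and> s ''x'' = x \<and> s ''i'' 0 = i \<and>
      output_list s = filter (\<lambda>v. T \<le> x v) (take i vs)"])
  fix i s
  assume i: "i < length vs" and I: "s ''in'' = inp \<and> s ''T'' 0 = T \<and> s ''x'' = x \<and> s ''i'' 0 = i \<and>
      output_list s = filter (\<lambda>v. T \<le> x v) (take i vs)"
  \<comment> \<open>The length entry grows first; the cell that it newly exposes is then
    overwritten, so its old content is irrelevant.\<close>
  have append: "output_list (upd (upd s ''out'' 0 (Suc n)) ''out'' (Suc n) v) = output_list s @ [v]"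
    if "n = s ''out'' 0" for v n
    using that by (auto simp: output_list_def)
  have frame: "output_list (s(y := g)) = output_list s" if "y \<noteq> ''out''" for s y g
    using that by (simp add: output_list_def)
  show "wp (If (Minus (Plus (weight vertex) (Const 1)) aT)
       (Seq (Assign ''out'' (Plus (Var ''out'') (Const 1))) (Write ''out'' (Var ''out'') vertex)) Skip) 3
     (\<lambda>s'. (upd s' ''i'' 0 (Suc (s' ''i'' 0))) ''in'' = inp \<and> (upd s' ''i'' 0 (Suc (s' ''i'' 0))) ''T'' 0 = T \<and>
        (upd s' ''i'' 0 (Suc (s' ''i'' 0))) ''x'' = x \<and> (upd s' ''i'' 0 (Suc (s' ''i'' 0))) ''i'' 0 = Suc i \<and>
        output_list (upd s' ''i'' 0 (Suc (s' ''i'' 0))) = filter (\<lambda>v. T \<le> x v) (take (Suc i) vs)) s" (is "wp _ _ ?Q _")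
  proof (rule wp_If)
    assume "aval (Minus (Plus (weight vertex) (Const 1)) aT) s \<noteq> 0"
    with I i inp_vertex[OF i] append[OF refl, of "vs ! i"]
    show "wp (Seq (Assign ''out'' (Plus (Var ''out'') (Const 1))) (Write ''out'' (Var ''out'') vertex)) (3 - 1) ?Q s"
      by (intro wp_Write_Seq wp_Write) (auto simp: frame take_Suc_conv_app_nth)
  next
    assume "aval (Minus (Plus (weight vertex) (Const 1)) aT) s = 0"
    with I i inp_vertex[OF i] show "wp Skip (3 - 1) ?Q s"
      by (intro wp_Skip) (auto simp: frame take_Suc_conv_app_nth)
  qed simp
qed (use assms inp_0 T_le in \<open>auto simp: st_def T_def output_list_def\<close>)

lemma wp_cover_prog:
  "wp cover_prog (main_time + S * 11 + 10)
    (\<lambda>s. output_list s = filter (\<lambda>v. T \<le> fst (cover_weights T es bss) v) vs)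
    (initial_state (listing vs es bss))"
proof -
  have out: "wp output_loop (S * 5 + 2)
      (\<lambda>s. output_list s = filter (\<lambda>v. T \<le> fst (cover_weights T es bss) v) vs) s"
    if "\<exists>k i. st k i (cover_weights T es bss) s" for s
    using that wp_output_loop by (metis prod.collapse)
  show ?thesis
    unfolding cover_prog_def
    by (rule wp_Seq[OF wp_mono[OF wp_init order_refl
          wp_Seq[OF wp_mono[OF wp_main_loop order_refl out] order_refl]]]) auto
qed

end

section \<open>Polynomial bound and approximation guarantee\<close>

text \<open>The bound of \<open>wp_cover_prog\<close> with \<open>main_time\<close> and
  \<open>pass_time\<close> expanded; its degree is 6.\<close>

definition time_poly :: "nat poly" where
  "time_poly = (let x = [:0, 1:] in
     x * ([:2:] * x ^ 3 * (x * [:7:] + x * (x * [:7:] + [:12:]) + [:7:] + [:2:]) + [:4:]) + [:2:] +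
     x * [:11:] + [:10:])"

lemma poly_time_poly:
  "poly time_poly n =
     n * (2 * n ^ 3 * (n * 7 + n * (n * 7 + 12) + 7 + 2) + 4) + 2 + n * 11 + 10"
proof -
  have "poly [:c:] n = c" "poly [:0, 1:] n = n" for c n :: nat by simp_all
  then show ?thesis unfolding time_poly_def Let_def poly_mult poly_add poly_power by (simp only:)
qed

theorem theorem3:
  "\<exists>(alg :: com) (p :: nat poly).
     \<forall>(V :: nat set) (E :: nat set set) (\<B> :: nat set set) (xs :: nat list).
       simple_graph V E \<longrightarrow> \<B> \<subseteq> Pow V \<longrightarrow> encodes_instance V E \<B> xs \<longrightarrow>
       (\<exists>t s W.
          exec alg (initial_state xs) t s \<and>
          t \<le> poly p (input_size xs) \<and>
          distinct (output_list s) \<and> set (output_list s) = W \<and>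
          vertex_cover V E W \<and>
          sparseness \<B> W \<le> 2 * min_sparseness V E \<B>)"
proof (intro exI[of _ cover_prog] exI[of _ time_poly] allI impI)
  fix V E \<B> xs
  assume G: "simple_graph V E" and sub: "\<B> \<subseteq> Pow V" and "encodes_instance V E \<B> xs"
  then obtain vs es bss where vs: "distinct vs" "set vs = V"
    and es: "set (map (\<lambda>(u, v). {u, v}) es) = E"
    and bss: "\<forall>bs\<in>set bss. distinct bs" "set (map set bss) = \<B>"
    and xs: "xs = listing vs es bss"
    unfolding encodes_instance_def listing_def by blast
  \<comment> \<open>Each number contributes at least its delimiter bit, so the input size can play
    the role of \<open>S\<close>.\<close>
  have "length xs = (\<Sum>x\<leftarrow>xs. 1)" by (simp add: sum_list_triv)
  also have "\<dots> \<le> input_size xs" unfolding input_size_def by (intro sum_list_mono) simp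
  finally interpret run vs es bss "input_size xs" by unfold_locales (simp add: xs)
  obtain x f where xf: "cover_weights T es bss = (x, f)" by fastforce
  obtain t s where run: "exec cover_prog (initial_state xs) t s"
      "t \<le> main_time + input_size xs * 11 + 10" "output_list s = filter (\<lambda>v. T \<le> x v) vs"
    using wp_cover_prog xf unfolding wp_def xs by auto
  have time: "main_time + input_size xs * 11 + 10 = poly time_poly (input_size xs)"
    unfolding main_time_def pass_time_def poly_time_poly ..
  have fin: "finite V" using G by (simp add: simple_graph_def)
  have T: "T = card V + 1" using vs distinct_card[of vs] by (simp add: T_def)
  \<comment> \<open>This makes the set of covers nonempty, so the minimum is attained by some
    \<open>H\<close>.\<close>
  have "vertex_cover V E V"
    using G unfolding vertex_cover_def simple_graph_def by (fastforce simp: card_2_iff)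
  moreover have "finite {H. vertex_cover V E H}"
    by (rule finite_subset[of _ "Pow V"]) (auto simp: fin vertex_cover_def)
  ultimately have "min_sparseness V E \<B> \<in> sparseness \<B> ` {H. vertex_cover V E H}"
    unfolding min_sparseness_def by (intro Min_in) auto
  then obtain H where H: "vertex_cover V E H" "min_sparseness V E \<B> = sparseness \<B> H" by auto
  have finB: "finite \<B>" using sub fin by (meson finite_Pow_iff finite_subset)
  have H_le: "card (H \<inter> B) \<le> sparseness \<B> H" if "B \<in> \<B>" for B
    unfolding sparseness_def using finB that by (intro Max_ge) auto
  \<comment> \<open>Hence the optimal value is among the guesses
    \<open>0, ..., T - 1\<close>.\<close>
  have "sparseness \<B> H \<le> card V"
    unfolding sparseness_def using finB sub fin by (auto intro!: card_mono)
  then have opt: "sparseness \<B> H < T" using T by simp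
  have edge: "u \<in> V \<and> v \<in> V \<and> u \<noteq> v \<and> (u \<in> H \<or> v \<in> H)" if "(u, v) \<in> set es" for u v
  proof -
    have "{u, v} \<in> E" using imageI[OF that, of "\<lambda>(u, v). {u, v}"] es by simp
    \<comment> \<open>Cardinality 2 excludes \<open>u = v\<close>, where the set would be a
      singleton.\<close>
    then have "{u, v} \<subseteq> V \<and> card {u, v} = 2" "H \<inter> {u, v} \<noteq> {}"
      using G H(1) by (simp_all only: simple_graph_def vertex_cover_def not_False_eq_True)
    then show ?thesis by (cases "u = v") auto
  qed
  have member: "set bs \<subseteq> V \<and> distinct bs \<and> card (H \<inter> set bs) \<le> sparseness \<B> H"
    if "bs \<in> set bss" for bs
    using that bss sub H_le[of "set bs"] by auto
  note good = cover_weights_correct[OF fin T edge member opt xf]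
  let ?W = "{v \<in> V. T \<le> x v}"
  have W: "set (output_list s) = ?W" using run(3) vs by auto
  have "vertex_cover V E ?W"
    unfolding vertex_cover_def
  proof (intro conjI ballI)
    fix e assume "e \<in> E"
    then obtain u v where "(u, v) \<in> set es" "e = {u, v}" using es by auto
    moreover from this have "u \<in> V" "v \<in> V" "T \<le> x u \<or> T \<le> x v" using good edge by auto
    ultimately show "?W \<inter> e \<noteq> {}" by auto
  qed auto
  moreover have "card (?W \<inter> B) \<le> 2 * sparseness \<B> H" if "B \<in> \<B>" for B
  proof -
    obtain bs where "bs \<in> set bss" "B = set bs" using \<open>B \<in> \<B>\<close> bss(2) by auto
    moreover from this have "?W \<inter> B = {v \<in> set bs. T \<le> x v}" using member by auto
    ultimately show ?thesis using good by simp
  qed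
  then have "sparseness \<B> ?W \<le> 2 * min_sparseness V E \<B>"
    unfolding H(2) sparseness_def[of \<B> ?W] using finB by auto
  moreover have "distinct (output_list s)" using run(3) vs by simp
  ultimately show "\<exists>t s W. exec cover_prog (initial_state xs) t s \<and> t \<le> poly time_poly (input_size xs) \<and>
      distinct (output_list s) \<and> set (output_list s) = W \<and> vertex_cover V E W \<and>
      sparseness \<B> W \<le> 2 * min_sparseness V E \<B>"
    using run(1,2) time W by (intro exI[of _ t] exI[of _ s] exI[of _ ?W]) simp
qed

end
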